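(* Let $I,J\subseteq\mathbb R$ be open intervals, let $a:I\to\mathbb R$ and $b_1,b_2:J\to\mathbb R$ be arbitrary continuous functions and let $z$ be a nonzero real number. Put $$\Xi(x):=\exp\left(-\int^x a(\xi)\,\mathrm d\xi\right),\qquad \gamma(t):=\int^t b_1(\tau)\,\mathrm d\tau .$$ The general solution of the first-order system of deformed extended generalized Buchdahl equations ($x\in I$, $y\neq0$, $t\in J$) $$\begin{aligned} \frac{\mathrm dx}{\mathrm dt}&=y+b_1(t)\left(\frac{\exp\bigl(zy\,\Xi(x)\bigr)-1-zy\,\Xi(x)}{zy\,\Xi^2(x)}\right)\exp\bigl(-zy\,\Xi(x)\bigr)\int^x\Xi(\xi)\,\mathrm d\xi\\ &\quad-b_2(t)\left(\frac{1+zy\,\Xi(x)}{y\,\Xi^2(x)}\right)\exp\bigl(-zy\,\Xi(x)\bigr)\int^x\Xi(\xi)\,\mathrm d\xi,\\ \frac{\mathrm dy}{\mathrm dt}&=a(x)y^2+b_1(t)\exp\bigl(-zy\,\Xi(x)\bigr)\\ &\quad\times\left(\frac{\exp\bigl(zy\,\Xi(x)\bigr)-1}{z\,\Xi(x)}+\frac{\exp\bigl(zy\,\Xi(x)\bigr)-1-zy\,\Xi(x)}{z\,\Xi^2(x)}\,a(x)\int^x\Xi(\xi)\,\mathrm d\xi\right)\\ &\quad-b_2(t)\,\frac{\exp\bigl(-zy\,\Xi(x)\bigr)}{\Xi^2(x)}\left(\Xi(x)+\bigl(1+zy\,\Xi(x)\bigr)a(x)\int^x\Xi(\xi)\,\mathrm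 d\xi\right) \end{aligned}$$ is given by $$\begin{aligned} \int^x\Xi(\xi)\,\mathrm d\xi&=\frac1z\ln\left\{1-z\mathrm e^{\gamma(t)}\left(c_1+\int^t\mathrm e^{-\gamma(\tau)}b_2(\tau)\,\mathrm d\tau\right)\right\}\left\{\mathrm e^{-\gamma(t)}-z\left(c_1+\int^t\mathrm e^{-\gamma(\tau)}b_2(\tau)\,\mathrm d\tau\right)\right\}\\ &\quad\times\left\{c_2+\int^t\left(\mathrm e^{-\gamma(\tau)}-z\left(c_1+\int^\tau\mathrm e^{-\gamma(\tau')}b_2(\tau')\,\mathrm d\tau'\right)\right)^{-1}\mathrm d\tau\right\},\\ y(t)&=\frac{1}{z\,\Xi(x)}\ln\left\{1-z\mathrm e^{\gamma(t)}\left(c_1+\int^t\mathrm e^{-\gamma(\tau)}b_2(\tau)\,\mathrm d\tau\right)\right\}, \end{aligned}$$ where $c_1$ and $c_2$ are the two integration constants provided by the initial conditions. That is, for functions $x:J'\to I$ and $y:J'\to\mathbb R\setminus\{0\}$ on an open interval $J'\subseteq J$, the pair $(x(t),y(t))$ is a solution of the system on $J'$ if and only if there are real constants $c_1,c_2$, with $1-z\mathrm e^{\gamma(t)}\bigl(c_1+\int^t\mathrm e^{-\gamma(\tau)}b_2(\tau)\,\mathrm d\tau\bigr)>0$ on $J'$, such that the two displayed formulas hold for all $t\in J'$.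
   Context: Indefinite integrals $\int^x(\cdot)\,\mathrm d\xi$ and $\int^t(\cdot)\,\mathrm d\tau$ denote antiderivatives of the integrand, chosen once and for all (the same choice wherever the same integral appears; the outer antiderivative in the last factor of the first formula is taken on the interval $J'$ where the solution is defined); thus $\Xi>0$, $\Xi'=-a\,\Xi$, $\gamma'=b_1$. The variable $y$ is assumed nonzero throughout. *)

theory Defs
  imports "HOL-Analysis.Analysis"
begin

definition antiderivative_on :: "(real \<Rightarrow> real) \<Rightarrow> (real \<Rightarrow> real) \<Rightarrow> real set \<Rightarrow> bool" where
  "antiderivative_on F f S \<longleftrightarrow> (\<forall>s\<in>S. (F has_real_derivative f s) (at s within S))"

text \<open>
  Indefinite integrals are passed around as chosen antiderivatives:
  \<open>A\<close> stands for the integral of \<open>a\<close>, \<open>G\<close> for that of \<open>Xi A\<close>, \<open>\<gamma>\<close> for that of \<open>b1\<close>,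
  and \<open>B\<close> for that of \<open>\<lambda>\<tau>. exp (- \<gamma> \<tau>) * b2 \<tau>\<close>.
\<close>

definition Xi :: "(real \<Rightarrow> real) \<Rightarrow> real \<Rightarrow> real" where
  "Xi A x = exp (- A x)"

definition buchdahl_dx ::
  "real \<Rightarrow> (real \<Rightarrow> real) \<Rightarrow> (real \<Rightarrow> real) \<Rightarrow> (real \<Rightarrow> real) \<Rightarrow> (real \<Rightarrow> real)
    \<Rightarrow> real \<Rightarrow> real \<Rightarrow> real \<Rightarrow> real" where
  "buchdahl_dx z A G b1 b2 t x y =
     y
     + b1 t * ((exp (z * y * Xi A x) - 1 - z * y * Xi A x) / (z * y * (Xi A x)\<^sup>2))
         * exp (- z * y * Xi A x) * G x
     - b2 t * ((1 + z * y * Xi A x) / (y * (Xi A x)\<^sup>2))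
         * exp (- z * y * Xi A x) * G x"

definition buchdahl_dy ::
  "real \<Rightarrow> (real \<Rightarrow> real) \<Rightarrow> (real \<Rightarrow> real) \<Rightarrow> (real \<Rightarrow> real) \<Rightarrow> (real \<Rightarrow> real) \<Rightarrow> (real \<Rightarrow> real)
    \<Rightarrow> real \<Rightarrow> real \<Rightarrow> real \<Rightarrow> real" where
  "buchdahl_dy z a A G b1 b2 t x y =
     a x * y\<^sup>2
     + b1 t * exp (- z * y * Xi A x)
         * ((exp (z * y * Xi A x) - 1) / (z * Xi A x)
            + (exp (z * y * Xi A x) - 1 - z * y * Xi A x) / (z * (Xi A x)\<^sup>2) * a x * G x)
     - b2 t * (exp (- z * y * Xi A x) / (Xi A x)\<^sup>2)
         * (Xi A x + (1 + z * y * Xi A x) * a x * G x)"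

definition buchdahl_solution_on ::
  "real \<Rightarrow> (real \<Rightarrow> real) \<Rightarrow> (real \<Rightarrow> real) \<Rightarrow> (real \<Rightarrow> real) \<Rightarrow> (real \<Rightarrow> real) \<Rightarrow> (real \<Rightarrow> real)
    \<Rightarrow> real set \<Rightarrow> (real \<Rightarrow> real) \<Rightarrow> (real \<Rightarrow> real) \<Rightarrow> bool" where
  "buchdahl_solution_on z a A G b1 b2 S x y \<longleftrightarrow>
     (\<forall>t\<in>S. (x has_real_derivative buchdahl_dx z A G b1 b2 t (x t) (y t)) (at t within S)
          \<and> (y has_real_derivative buchdahl_dy z a A G b1 b2 t (x t) (y t)) (at t within S))"

end

theory Submission
  imports Defs
begin

text \<open>
  In the coordinates \<open>g = G (x t)\<close> and \<open>u = y t * Xi A (x t)\<close> the system decouples. The equation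
  for \<open>u\<close> involves neither \<open>a\<close> nor \<open>g\<close>, and for \<open>exp (z * u) - 1\<close> it becomes linear with
  coefficient \<open>b1\<close>. The equation for \<open>g\<close> is linear with coefficient the logarithmic derivative
  of \<open>u * exp (- \<gamma>) * exp (z * u)\<close> and inhomogeneity \<open>u\<close>. Variation of constants solves both and
  produces \<open>c1\<close> and \<open>c2\<close>. As \<open>G\<close> is a local diffeomorphism that is injective on \<open>I\<close>, \<open>x\<close> and \<open>y\<close>
  can be recovered from \<open>g\<close> and \<open>u\<close> without losing differentiability.
\<close>

section \<open>Scalar linear equations and differentiability through an injective map\<close>

text \<open>Variation of constants: \<open>q\<close> is a nowhere zero solution of the homogeneous
  equation, so the quotient rule gives \<open>g / q - K\<close> derivative zero, and convexity of
  \<open>S\<close> makes it constant. The converse is the product rule.\<close>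

lemma linear_ode_iff:
  fixes S :: "real set" and q m r K g :: "real \<Rightarrow> real"
  assumes "convex S"
    and q0: "\<And>t. t \<in> S \<Longrightarrow> q t \<noteq> 0"
    and dq: "\<And>t. t \<in> S \<Longrightarrow> (q has_real_derivative m t * q t) (at t within S)"
    and dK: "\<And>t. t \<in> S \<Longrightarrow> (K has_real_derivative r t / q t) (at t within S)"
  shows "(\<forall>t\<in>S. (g has_real_derivative m t * g t + r t) (at t within S))
    \<longleftrightarrow> (\<exists>c. \<forall>t\<in>S. g t = q t * (c + K t))"
proof
  assume g: "\<forall>t\<in>S. (g has_real_derivative m t * g t + r t) (at t within S)"
  have "((\<lambda>s. g s / q s - K s) has_real_derivative 0) (at t within S)" if "t \<in> S" for t
  proof -
    have "((\<lambda>s. g s / q s - K s) has_real_derivative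
      ((m t * g t + r t) * q t - g t * (m t * q t)) / (q t * q t) - r t / q t) (at t within S)"
      using that g q0 dq dK by (intro DERIV_diff DERIV_divide) auto
    moreover have "((m t * g t + r t) * q t - g t * (m t * q t)) / (q t * q t) - r t / q t = 0"
      using q0[OF that] by (simp add: field_simps)
    ultimately show ?thesis by simp
  qed
  from has_field_derivative_zero_constant[OF \<open>convex S\<close> this]
  obtain c where c: "\<And>t. t \<in> S \<Longrightarrow> g t / q t - K t = c" by blast
  have "g t = q t * (c + K t)" if "t \<in> S" for t
    using c[OF that] q0[OF that] by (simp add: field_simps)
  then show "\<exists>c. \<forall>t\<in>S. g t = q t * (c + K t)" by blast
next
  assume "\<exists>c. \<forall>t\<in>S. g t = q t * (c + K t)"
  then obtain c where c: "\<And>t. t \<in> S \<Longrightarrow> g t = q t * (c + K t)" by blast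
  show "\<forall>t\<in>S. (g has_real_derivative m t * g t + r t) (at t within S)"
  proof
    fix t assume t: "t \<in> S"
    have "((\<lambda>s. q s * (c + K s)) has_real_derivative
        q t * (0 + r t / q t) + m t * q t * (c + K t)) (at t within S)"
      by (intro DERIV_mult' DERIV_add DERIV_const dq dK t)
    moreover have "q t * (0 + r t / q t) + m t * q t * (c + K t) = m t * g t + r t"
      using q0[OF t] c[OF t] by simp
    ultimately have "((\<lambda>s. q s * (c + K s)) has_real_derivative m t * g t + r t) (at t within S)"
      by simp
    then show "(g has_real_derivative m t * g t + r t) (at t within S)"
      unfolding has_field_derivative_def
      by (rule has_derivative_transform[rotated 2]) (use c t in auto)
  qed
qed

text \<open>Differentiability of \<open>x\<close> is a conclusion here: on \<open>S\<close>,
  \<open>x\<close> is the local inverse \<open>inv_into I G\<close> applied to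
  \<open>G (x s)\<close>, and the inverse function theorem gives that inverse the derivative
  \<open>1 / D\<close> at \<open>G (x t)\<close>.\<close>

lemma has_real_derivative_of_comp:
  fixes G x :: "real \<Rightarrow> real"
  assumes "open I" "continuous_on I G" "inj_on G I"
    and xI: "\<forall>s\<in>S. x s \<in> I" and t: "t \<in> S"
    and dG: "(G has_real_derivative D) (at (x t))" and "D \<noteq> 0"
    and dGx: "((\<lambda>s. G (x s)) has_real_derivative E) (at t within S)"
  shows "(x has_real_derivative E / D) (at t within S)"
proof -
  have "(inv_into I G has_derivative (*) (inverse D)) (at (G (x t)))"
  proof (rule has_derivative_inverse_strong[where S = I and f = G and x = "x t" and f' = "(*) D"])
    show "inv_into I G (G s) = s" if "s \<in> I" for s
      using \<open>inj_on G I\<close> that by simp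
    show "(G has_derivative (*) D) (at (x t))"
      using dG by (simp add: has_field_derivative_def)
    show "(*) D \<circ> (*) (inverse D) = id"
      using \<open>D \<noteq> 0\<close> by (auto simp: fun_eq_iff)
  qed (use assms in auto)
  then have "(inv_into I G has_real_derivative inverse D) (at (G (x t)))"
    by (simp add: has_field_derivative_def)
  from DERIV_chain2[OF this dGx]
  have "((\<lambda>s. inv_into I G (G (x s))) has_real_derivative E / D) (at t within S)"
    by (simp add: field_simps)
  then show ?thesis
    unfolding has_field_derivative_def
    by (rule has_derivative_transform[rotated 2]) (use xI \<open>inj_on G I\<close> t in auto)
qed

section \<open>The system in the coordinates \<open>g\<close> and \<open>u\<close>\<close>

definition reduced_du :: "real \<Rightarrow> real \<Rightarrow> real \<Rightarrow> real \<Rightarrow> real" where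
  "reduced_du z \<beta>1 \<beta>2 u = \<beta>1 * (1 - exp (- z * u)) / z - \<beta>2 * exp (- z * u)"

text \<open>For nonzero \<open>z\<close> and \<open>u\<close> this equals \<open>(1 + z * u) / u *
  reduced_du z \<beta>1 \<beta>2 u - \<beta>1\<close>, where \<open>\<beta>1\<close> and
  \<open>\<beta>2\<close> stand for the values of \<open>b1\<close> and \<open>b2\<close> at the
  current time.\<close>

definition reduced_m :: "real \<Rightarrow> real \<Rightarrow> real \<Rightarrow> real \<Rightarrow> real" where
  "reduced_m z \<beta>1 \<beta>2 u =
     (\<beta>1 * (exp (z * u) - 1 - z * u) / z - \<beta>2 * (1 + z * u)) * exp (- z * u) / u"

text \<open>As \<open>G\<close> has derivative \<open>Xi A\<close>, the left side is the derivative
  of \<open>G (x t)\<close> along a solution.\<close>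

lemma Xi_buchdahl_dx:
  assumes "y \<noteq> 0" "z \<noteq> 0"
  shows "Xi A x * buchdahl_dx z A G b1 b2 t x y =
    reduced_m z (b1 t) (b2 t) (y * Xi A x) * G x + y * Xi A x"
proof -
  \<comment> \<open>Free variables replace the exponential and the numerators, so that a purely
    rational identity remains.\<close>
  have "X * (y + \<beta>1 * (N / (z * y * X\<^sup>2)) * F * g - \<beta>2 * (M / (y * X\<^sup>2)) * F * g)
      = (\<beta>1 * N / z - \<beta>2 * M) * F / (y * X) * g + y * X" if "X \<noteq> 0" for X N F M g \<beta>1 \<beta>2 :: real
    using assms that by (simp add: field_simps power2_eq_square)
  from this[of "Xi A x"] show ?thesis
    by (simp add: buchdahl_dx_def reduced_m_def Xi_def mult.assoc)
qed

text \<open>Since \<open>Xi A\<close> has derivative \<open>- a * Xi A\<close>, the product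
  \<open>y * Xi A x\<close> changes at the rate
  \<open>Xi A x * dy - a x * y * (Xi A x * dx)\<close>. The identity says that all terms containing
  \<open>a\<close> or \<open>G\<close> cancel in this rate.\<close>

lemma Xi_buchdahl_dy:
  assumes "y \<noteq> 0" "z \<noteq> 0"
  shows "Xi A x * buchdahl_dy z a A G b1 b2 t x y =
    reduced_du z (b1 t) (b2 t) (y * Xi A x) + a x * y * (Xi A x * buchdahl_dx z A G b1 b2 t x y)"
proof -
  have "X * (\<alpha> * y\<^sup>2 + \<beta>1 * F * ((E - 1) / (z * X) + N / (z * X\<^sup>2) * \<alpha> * g)
          - \<beta>2 * (F / X\<^sup>2) * (X + M * \<alpha> * g))
      = \<beta>1 * (F * E - F) / z - \<beta>2 * F
        + \<alpha> * y * (X * (y + \<beta>1 * (N / (z * y * X\<^sup>2)) * F * g - \<beta>2 * (M / (y * X\<^sup>2)) * F * g))"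
    if "X \<noteq> 0" for X \<alpha> E N F M g \<beta>1 \<beta>2 :: real
    using assms that by (simp add: field_simps power2_eq_square)
  note eq = this[of "Xi A x" "a x" "b1 t" "exp (- z * y * Xi A x)" "exp (z * y * Xi A x)"]
  \<comment> \<open>In the rational identity \<open>E\<close> and \<open>F\<close> are independent;
    their relation enters only now and turns \<open>F * E - F\<close> into
    \<open>1 - exp (- z * u)\<close>.\<close>
  have "exp (- z * y * Xi A x) * exp (z * y * Xi A x) = 1"
    by (simp flip: exp_add)
  moreover have "Xi A x \<noteq> 0" by (simp add: Xi_def)
  ultimately show ?thesis
    using eq by (simp add: buchdahl_dx_def buchdahl_dy_def reduced_du_def mult.assoc)
qed

text \<open>Forwards this is the chain and product rule. Backwards, differentiability has to be
  recovered in order: first \<open>x\<close> from \<open>G (x s)\<close>, then \<open>y\<close> from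
  \<open>u\<close> and \<open>x\<close>.\<close>

lemma buchdahl_solution_on_iff_reduced:
  fixes I S :: "real set"
  assumes "open I" "is_interval I" "z \<noteq> 0"
    and A: "antiderivative_on A a I" and G: "antiderivative_on G (Xi A) I"
    and xI: "\<forall>t\<in>S. x t \<in> I" and y0: "\<forall>t\<in>S. y t \<noteq> 0"
  defines "u \<equiv> \<lambda>t. y t * Xi A (x t)"
  shows "buchdahl_solution_on z a A G b1 b2 S x y \<longleftrightarrow>
    (\<forall>t\<in>S. (u has_real_derivative reduced_du z (b1 t) (b2 t) (u t)) (at t within S)) \<and>
    (\<forall>t\<in>S. ((\<lambda>s. G (x s)) has_real_derivative
        reduced_m z (b1 t) (b2 t) (u t) * G (x t) + u t) (at t within S))"
    (is "_ \<longleftrightarrow> ?R")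
proof -
  have Xi_pos: "Xi A s > 0" for s by (simp add: Xi_def)
  have dA: "(A has_real_derivative a s) (at s)" if "s \<in> I" for s
    using A that at_within_open[OF that \<open>open I\<close>] unfolding antiderivative_on_def by metis
  have dG: "(G has_real_derivative Xi A s) (at s)" if "s \<in> I" for s
    using G that at_within_open[OF that \<open>open I\<close>] unfolding antiderivative_on_def by metis
  have dXi: "(Xi A has_real_derivative - a s * Xi A s) (at s)" if "s \<in> I" for s
    unfolding Xi_def[abs_def] by (auto intro!: derivative_eq_intros dA that)
  have contG: "continuous_on I G"
    using dG by (meson DERIV_isCont continuous_at_imp_continuous_on)
  \<comment> \<open>The derivative \<open>Xi A\<close> is positive, and since \<open>I\<close> is an
    interval every point between \<open>r\<close> and \<open>s\<close> lies in it.\<close>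
  have "strict_mono_on I G"
  proof (rule strict_mono_onI)
    fix r s assume rs: "r \<in> I" "s \<in> I" "r < s"
    then have "\<And>v. r \<le> v \<Longrightarrow> v \<le> s \<Longrightarrow> v \<in> I"
      using \<open>is_interval I\<close> by (meson mem_is_interval_1_I)
    with rs(3) show "G r < G s"
      using dG Xi_pos by (intro DERIV_pos_imp_increasing[of r s G]) blast+
  qed
  then have injG: "inj_on G I" by (rule strict_mono_on_imp_inj_on)
  let ?dx = "\<lambda>t. buchdahl_dx z A G b1 b2 t (x t) (y t)"
  let ?dy = "\<lambda>t. buchdahl_dy z a A G b1 b2 t (x t) (y t)"
  have dx_eq: "reduced_m z (b1 t) (b2 t) (u t) * G (x t) + u t = Xi A (x t) * ?dx t" if "t \<in> S" for t
    using Xi_buchdahl_dx[of "y t" z] y0 that \<open>z \<noteq> 0\<close> by (simp add: u_def)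
  have dy_eq: "Xi A (x t) * ?dy t = reduced_du z (b1 t) (b2 t) (u t) + a (x t) * y t * (Xi A (x t) * ?dx t)"
    if "t \<in> S" for t
    using Xi_buchdahl_dy[of "y t" z] y0 that \<open>z \<noteq> 0\<close> by (simp add: u_def)
  show ?thesis
  proof
    assume sol: "buchdahl_solution_on z a A G b1 b2 S x y"
    show ?R
    proof (intro conjI ballI)
      fix t assume t: "t \<in> S"
      have dx: "(x has_real_derivative ?dx t) (at t within S)"
        and dy: "(y has_real_derivative ?dy t) (at t within S)"
        using sol t by (auto simp: buchdahl_solution_on_def)
      have xt: "x t \<in> I" using xI t by blast
      show "((\<lambda>s. G (x s)) has_real_derivative
        reduced_m z (b1 t) (b2 t) (u t) * G (x t) + u t) (at t within S)"
        using DERIV_chain2[OF dG[OF xt] dx] dx_eq[OF t] by simp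
      have "(u has_real_derivative
          y t * (- a (x t) * Xi A (x t) * ?dx t) + ?dy t * Xi A (x t)) (at t within S)"
        unfolding u_def
        by (rule DERIV_mult'[OF dy DERIV_chain2[OF dXi[OF xt] dx]])
      then show "(u has_real_derivative reduced_du z (b1 t) (b2 t) (u t)) (at t within S)"
        using dy_eq[OF t] by (simp add: algebra_simps)
    qed
  next
    assume R: ?R
    show "buchdahl_solution_on z a A G b1 b2 S x y"
      unfolding buchdahl_solution_on_def
    proof (intro ballI)
      fix t assume t: "t \<in> S"
      let ?du = "reduced_du z (b1 t) (b2 t) (u t)"
      have xt: "x t \<in> I" using xI t by blast
      have X0: "Xi A (x t) \<noteq> 0" using Xi_pos[of "x t"] by simp
      have "((\<lambda>s. G (x s)) has_real_derivative Xi A (x t) * ?dx t) (at t within S)"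
        using R t by (simp flip: dx_eq[OF t])
      from has_real_derivative_of_comp[OF \<open>open I\<close> contG injG xI t dG[OF xt] X0 this]
      have dx: "(x has_real_derivative ?dx t) (at t within S)"
        using X0 by simp
      \<comment> \<open>With \<open>x\<close> now differentiable, \<open>y\<close> is written as
        \<open>u / Xi A (x s)\<close>, and the quotient rule undoes the cancellation in
        \<open>dy_eq\<close>.\<close>
      have "((\<lambda>s. u s / Xi A (x s)) has_real_derivative
          (?du * Xi A (x t) - u t * (- a (x t) * Xi A (x t) * ?dx t)) / (Xi A (x t) * Xi A (x t)))
          (at t within S)"
        using R t by (intro DERIV_divide DERIV_chain2[OF dXi[OF xt] dx] X0) auto
      moreover have "(\<lambda>s. u s / Xi A (x s)) = y"
        using Xi_pos by (auto simp: u_def fun_eq_iff less_le)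
      moreover have "(?du * Xi A (x t) - u t * (- a (x t) * Xi A (x t) * ?dx t)) / (Xi A (x t) * Xi A (x t))
          = (Xi A (x t) * ?dy t) / Xi A (x t)"
        unfolding dy_eq[OF t] using X0 by (simp add: u_def field_simps)
      ultimately show "(x has_real_derivative ?dx t) (at t within S)
          \<and> (y has_real_derivative ?dy t) (at t within S)"
        using dx X0 by simp
    qed
  qed
qed

section \<open>Solving the decoupled equations\<close>

text \<open>The substitution \<open>v = exp (z * u) - 1\<close> is inverted by
  \<open>u = ln (v + 1) / z\<close>, so it transfers differentiability in both directions.\<close>

lemma has_real_derivative_iff_exp:
  fixes u :: "real \<Rightarrow> real"
  assumes "z \<noteq> 0"
  shows "(u has_real_derivative D) (at t within S) \<longleftrightarrow>
    ((\<lambda>s. exp (z * u s) - 1) has_real_derivative z * exp (z * u t) * D) (at t within S)"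
proof
  assume "(u has_real_derivative D) (at t within S)"
  then show "((\<lambda>s. exp (z * u s) - 1) has_real_derivative z * exp (z * u t) * D) (at t within S)"
    by (auto intro!: derivative_eq_intros)
next
  assume d: "((\<lambda>s. exp (z * u s) - 1) has_real_derivative z * exp (z * u t) * D) (at t within S)"
  define v where "v = (\<lambda>s. exp (z * u s) - 1)"
  have v: "v s + 1 = exp (z * u s)" for s
    by (simp add: v_def)
  have "((\<lambda>s. ln (v s + 1) / z) has_real_derivative D) (at t within S)"
    using \<open>z \<noteq> 0\<close> by (auto intro!: derivative_eq_intros d[folded v_def] simp: v[of t])
  then show "(u has_real_derivative D) (at t within S)"
    using \<open>z \<noteq> 0\<close> by (simp add: v)
qed

text \<open>For \<open>v = exp (z * u) - 1\<close> the equation reads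
  \<open>v' = b1 * v - z * b2\<close>. Here \<open>exp \<gamma>\<close> solves the homogeneous part,
  and the antiderivative required by variation of constants is \<open>- z * B\<close>.\<close>

lemma reduced_u_iff:
  fixes S :: "real set"
  assumes "convex S" "z \<noteq> 0"
    and dg: "\<And>t. t \<in> S \<Longrightarrow> (\<gamma> has_real_derivative b1 t) (at t within S)"
    and dB: "\<And>t. t \<in> S \<Longrightarrow> (B has_real_derivative exp (- \<gamma> t) * b2 t) (at t within S)"
  shows "(\<forall>t\<in>S. (u has_real_derivative reduced_du z (b1 t) (b2 t) (u t)) (at t within S)) \<longleftrightarrow>
    (\<exists>c1. \<forall>t\<in>S. exp (z * u t) = 1 - z * exp (\<gamma> t) * (c1 + B t))"
proof -
  have eq: "z * exp (z * u t) * reduced_du z (b1 t) (b2 t) (u t)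
      = b1 t * (exp (z * u t) - 1) + - z * b2 t" for t
    using \<open>z \<noteq> 0\<close> by (simp add: reduced_du_def exp_minus field_simps)
  have "(\<forall>t\<in>S. (u has_real_derivative reduced_du z (b1 t) (b2 t) (u t)) (at t within S)) \<longleftrightarrow>
    (\<forall>t\<in>S. ((\<lambda>s. exp (z * u s) - 1) has_real_derivative
        b1 t * (exp (z * u t) - 1) + - z * b2 t) (at t within S))"
    by (intro ball_cong refl) (subst has_real_derivative_iff_exp[OF \<open>z \<noteq> 0\<close>], simp only: eq)
  also have "\<dots> \<longleftrightarrow> (\<exists>c. \<forall>t\<in>S. exp (z * u t) - 1 = exp (\<gamma> t) * (c + - z * B t))"
  proof (rule linear_ode_iff[OF \<open>convex S\<close>])
    fix t assume t: "t \<in> S"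
    show "((\<lambda>t. exp (\<gamma> t)) has_real_derivative b1 t * exp (\<gamma> t)) (at t within S)"
      by (auto intro!: derivative_eq_intros dg[OF t])
    show "((\<lambda>t. - z * B t) has_real_derivative - z * b2 t / exp (\<gamma> t)) (at t within S)"
      using DERIV_cmult[OF dB[OF t], of "- z"] by (simp add: exp_minus divide_inverse mult_ac)
  qed simp
  \<comment> \<open>The constants correspond by \<open>c = - z * c1\<close>, which is invertible
    because \<open>z\<close> is nonzero.\<close>
  also have "\<dots> \<longleftrightarrow> (\<exists>c1. \<forall>t\<in>S. exp (z * u t) = 1 - z * exp (\<gamma> t) * (c1 + B t))"
  proof
    assume "\<exists>c. \<forall>t\<in>S. exp (z * u t) - 1 = exp (\<gamma> t) * (c + - z * B t)"
    then obtain c where c: "\<forall>t\<in>S. exp (z * u t) - 1 = exp (\<gamma> t) * (c + - z * B t)" ..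
    show "\<exists>c1. \<forall>t\<in>S. exp (z * u t) = 1 - z * exp (\<gamma> t) * (c1 + B t)"
    proof (intro exI ballI)
      fix t assume "t \<in> S"
      moreover have "z * exp (\<gamma> t) * (- c / z + B t) = - (exp (\<gamma> t) * (c + - z * B t))"
        using \<open>z \<noteq> 0\<close> by (simp add: field_simps)
      ultimately show "exp (z * u t) = 1 - z * exp (\<gamma> t) * (- c / z + B t)"
        using c by (metis diff_minus_eq_add add.commute diff_add_cancel)
    qed
  next
    assume "\<exists>c1. \<forall>t\<in>S. exp (z * u t) = 1 - z * exp (\<gamma> t) * (c1 + B t)"
    then obtain c1 where "\<forall>t\<in>S. exp (z * u t) = 1 - z * exp (\<gamma> t) * (c1 + B t)" ..
    then show "\<exists>c. \<forall>t\<in>S. exp (z * u t) - 1 = exp (\<gamma> t) * (c + - z * B t)"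
      by (intro exI[of _ "- z * c1"]) (auto simp: algebra_simps)
  qed
  finally show ?thesis .
qed

text \<open>Variation of constants with \<open>q = u * exp (- \<gamma>) * exp (z * u)\<close> and
  inhomogeneity \<open>u\<close>: the factor \<open>u\<close> cancels in the quotient, leaving the
  integrand of \<open>K\<close>.\<close>

lemma reduced_g_iff:
  fixes S :: "real set"
  assumes "convex S" "z \<noteq> 0"
    and dg: "\<And>t. t \<in> S \<Longrightarrow> (\<gamma> has_real_derivative b1 t) (at t within S)"
    and u0: "\<And>t. t \<in> S \<Longrightarrow> u t \<noteq> 0"
    and du: "\<And>t. t \<in> S \<Longrightarrow> (u has_real_derivative reduced_du z (b1 t) (b2 t) (u t)) (at t within S)"
    and dK: "\<And>t. t \<in> S \<Longrightarrow>
      (K has_real_derivative inverse (exp (- \<gamma> t) * exp (z * u t))) (at t within S)"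
  shows "(\<forall>t\<in>S. (g has_real_derivative reduced_m z (b1 t) (b2 t) (u t) * g t + u t) (at t within S))
    \<longleftrightarrow> (\<exists>c2. \<forall>t\<in>S. g t = u t * (exp (- \<gamma> t) * exp (z * u t)) * (c2 + K t))"
proof (rule linear_ode_iff[OF \<open>convex S\<close>])
  fix t assume t: "t \<in> S"
  show "u t * (exp (- \<gamma> t) * exp (z * u t)) \<noteq> 0"
    using u0[OF t] by simp
  show "(K has_real_derivative u t / (u t * (exp (- \<gamma> t) * exp (z * u t)))) (at t within S)"
    using dK[OF t] u0[OF t] by (simp add: field_simps)
  \<comment> \<open>The logarithmic derivative of the product is
    \<open>u' / u - b1 + z * u'\<close>; inserting \<open>reduced_du\<close> for \<open>u'\<close>
    gives \<open>reduced_m\<close>.\<close>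
  show "((\<lambda>t. u t * (exp (- \<gamma> t) * exp (z * u t))) has_real_derivative
      reduced_m z (b1 t) (b2 t) (u t) * (u t * (exp (- \<gamma> t) * exp (z * u t)))) (at t within S)"
    using u0[OF t] \<open>z \<noteq> 0\<close>
    by (auto intro!: derivative_eq_intros dg[OF t] du[OF t]
        simp: reduced_m_def reduced_du_def exp_minus field_simps)
qed

section \<open>The general solution in the original variables\<close>

text \<open>The outer integrand contains \<open>c1\<close>, so its antiderivative is a family
  \<open>K c1\<close>, constrained only for those \<open>c1\<close> whose logarithm has a positive
  argument on all of \<open>J'\<close>; there the inverted denominator is positive too.\<close>

theorem proposition7p2:
  fixes I J J' :: "real set"
    and a b1 b2 A G \<gamma> B x y :: "real \<Rightarrow> real"
    and K :: "real \<Rightarrow> real \<Rightarrow> real"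
    and z :: real
  assumes "open I" "is_interval I" "open J" "is_interval J"
    and "continuous_on I a" "continuous_on J b1" "continuous_on J b2"
    and "z \<noteq> 0"
    and "antiderivative_on A a I"
    and "antiderivative_on G (Xi A) I"
    and "antiderivative_on \<gamma> b1 J"
    and "antiderivative_on B (\<lambda>\<tau>. exp (- \<gamma> \<tau>) * b2 \<tau>) J"
    and "open J'" "is_interval J'" "J' \<subseteq> J"
    and "\<And>c1. (\<forall>t\<in>J'. 1 - z * exp (\<gamma> t) * (c1 + B t) > 0) \<Longrightarrow>
           antiderivative_on (K c1) (\<lambda>\<tau>. inverse (exp (- \<gamma> \<tau>) - z * (c1 + B \<tau>))) J'"
    and "\<forall>t\<in>J'. x t \<in> I" "\<forall>t\<in>J'. y t \<noteq> 0"
  shows "buchdahl_solution_on z a A G b1 b2 J' x y \<longleftrightarrow>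
    (\<exists>c1 c2. (\<forall>t\<in>J'. 1 - z * exp (\<gamma> t) * (c1 + B t) > 0) \<and>
       (\<forall>t\<in>J'.
          G (x t) = 1 / z * ln (1 - z * exp (\<gamma> t) * (c1 + B t))
                      * (exp (- \<gamma> t) - z * (c1 + B t)) * (c2 + K c1 t) \<and>
          y t = 1 / (z * Xi A (x t)) * ln (1 - z * exp (\<gamma> t) * (c1 + B t))))"
proof -
  note zne = \<open>z \<noteq> 0\<close>
  have conv: "convex J'"
    using \<open>is_interval J'\<close> by (rule is_interval_convex)
  have dg: "(\<gamma> has_real_derivative b1 t) (at t within J')" if "t \<in> J'" for t
    using \<open>antiderivative_on \<gamma> b1 J\<close> that \<open>J' \<subseteq> J\<close>
    by (auto simp: antiderivative_on_def intro: DERIV_subset)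
  have dB: "(B has_real_derivative exp (- \<gamma> t) * b2 t) (at t within J')" if "t \<in> J'" for t
    using \<open>antiderivative_on B _ J\<close> that \<open>J' \<subseteq> J\<close>
    by (auto simp: antiderivative_on_def intro: DERIV_subset)
  have Xi0: "Xi A s \<noteq> 0" for s by (simp add: Xi_def)
  define u where "u = (\<lambda>t. y t * Xi A (x t))"
  define W where "W = (\<lambda>c1 t. 1 - z * exp (\<gamma> t) * (c1 + B t))"
  have u0: "u t \<noteq> 0" if "t \<in> J'" for t
    using that \<open>\<forall>t\<in>J'. y t \<noteq> 0\<close> Xi0 by (simp add: u_def)
  \<comment> \<open>The second brace of the solution formula is thus
    \<open>exp (- \<gamma>) * exp (z * u)\<close> as soon as
    \<open>exp (z * u) = W c1\<close>.\<close>
  have W_eq: "exp (- \<gamma> t) - z * (c1 + B t) = exp (- \<gamma> t) * W c1 t" for c1 t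
    by (simp add: W_def exp_minus field_simps)
  \<comment> \<open>Positivity and the formula for \<open>y\<close> are handled as one condition,
    since \<open>exp\<close> undoes \<open>ln\<close> only at positive arguments.\<close>
  have y_iff: "W c1 t > 0 \<and> y t = 1 / (z * Xi A (x t)) * ln (W c1 t) \<longleftrightarrow> exp (z * u t) = W c1 t" for c1 t
  proof -
    have "y t = 1 / (z * Xi A (x t)) * ln (W c1 t) \<longleftrightarrow> z * u t = ln (W c1 t)"
      using zne Xi0[of "x t"] by (auto simp: u_def field_simps)
    then show ?thesis
      by (metis exp_gt_zero exp_ln ln_exp)
  qed
  let ?U = "\<forall>t\<in>J'. (u has_real_derivative reduced_du z (b1 t) (b2 t) (u t)) (at t within J')"
  let ?g = "\<lambda>s. G (x s)"
  let ?M = "\<forall>t\<in>J'. (?g has_real_derivative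
      reduced_m z (b1 t) (b2 t) (u t) * ?g t + u t) (at t within J')"
  let ?E = "\<lambda>c1. \<forall>t\<in>J'. exp (z * u t) = W c1 t"
  have U_iff: "?U \<longleftrightarrow> (\<exists>c1. ?E c1)"
    unfolding W_def using reduced_u_iff[where u = u, OF conv zne dg dB] .
  \<comment> \<open>The constant \<open>c1\<close> has to be fixed first: \<open>?E c1\<close>
    forces \<open>W c1\<close> to be positive, which makes the hypothesis on \<open>K c1\<close>
    available.\<close>
  have M_iff: "?M \<longleftrightarrow> (\<exists>c2. \<forall>t\<in>J'. ?g t = u t * (exp (- \<gamma> t) * exp (z * u t)) * (c2 + K c1 t))"
    if E: "?E c1" for c1
  proof (rule reduced_g_iff[OF conv zne dg u0])
    have "\<forall>t\<in>J'. 1 - z * exp (\<gamma> t) * (c1 + B t) > 0"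
      using E unfolding W_def by (metis exp_gt_zero)
    from assms(16)[OF this]
    show "(K c1 has_real_derivative inverse (exp (- \<gamma> t) * exp (z * u t))) (at t within J')"
      if "t \<in> J'" for t
      using that E by (simp add: antiderivative_on_def W_eq)
    show "(u has_real_derivative reduced_du z (b1 t) (b2 t) (u t)) (at t within J')"
      if "t \<in> J'" for t
      using U_iff E that by blast
  qed
  have "buchdahl_solution_on z a A G b1 b2 J' x y \<longleftrightarrow> ?U \<and> ?M"
    unfolding u_def by (rule buchdahl_solution_on_iff_reduced) (use assms in auto)
  also have "\<dots> \<longleftrightarrow> (\<exists>c1 c2. ?E c1 \<and>
      (\<forall>t\<in>J'. ?g t = u t * (exp (- \<gamma> t) * exp (z * u t)) * (c2 + K c1 t)))"
    using U_iff M_iff by blast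
  also have "\<dots> \<longleftrightarrow> (\<exists>c1 c2. (\<forall>t\<in>J'. W c1 t > 0) \<and>
       (\<forall>t\<in>J'. G (x t) = 1 / z * ln (W c1 t) * (exp (- \<gamma> t) - z * (c1 + B t)) * (c2 + K c1 t) \<and>
          y t = 1 / (z * Xi A (x t)) * ln (W c1 t)))"
  proof -
    have u_eq: "u t = 1 / z * ln (W c1 t)" if "exp (z * u t) = W c1 t" for c1 t
      using zne by (simp flip: that)
    \<comment> \<open>Both descriptions agree at each single \<open>t\<close> with the same
      \<open>c1\<close> and \<open>c2\<close>, so the quantifiers can be restored
      afterwards.\<close>
    have "(exp (z * u t) = W c1 t \<and>
          ?g t = u t * (exp (- \<gamma> t) * exp (z * u t)) * (c2 + K c1 t)) \<longleftrightarrow>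
        W c1 t > 0 \<and>
          G (x t) = 1 / z * ln (W c1 t) * (exp (- \<gamma> t) - z * (c1 + B t)) * (c2 + K c1 t) \<and>
          y t = 1 / (z * Xi A (x t)) * ln (W c1 t)" for c1 c2 t
      unfolding W_eq using y_iff[of c1 t] u_eq[of t c1] by auto
    then show ?thesis by (simp add: ball_conj_distrib[symmetric])
  qed
  finally show ?thesis unfolding W_def .
qed

end
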